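(* Let $0\le s<t\le T$ and suppose that $f\in\mathrm{Range}(Q_T(t,s))\subset H$, where $$Q_T(t,s)=\int_{T-t}^{T-s}\sigma(\tau)\sigma(\tau)^\ast\,\mathrm{d}\tau .$$ Then $f=g$ almost everywhere in $(0,T)$, where $g\colon(0,T)\to\mathbb{R}^d$ is a continuous function such that $g=0$ in $(0,T-t)$.
   Context: Fix $T>0$, $d\in\mathbb{N}$, $\alpha\in(\frac12,1)$. $H=L^2(0,T;\mathbb{R}^d)$ and $k_2(t)=\frac{1}{\Gamma(\alpha)}t^{\alpha-1}$ for $t>0$. The map $\sigma\colon[0,T]\to\mathcal{L}(\mathbb{R}^d;H)$ is $[\sigma(t)x](\xi)=k_2(\xi-t)1_{\{t<\xi\}}x$ for $x\in\mathbb{R}^d$, $t,\xi\in[0,T]$, and $\sigma(t)^\ast\colon H\to\mathbb{R}^d$ is its adjoint. $Q_T(t,s)$ is a bounded linear operator on $H$ (it is the covariance operator of the centered Gaussian variable $\int_s^t\sigma(T-r)\,\mathrm{d}W_r$, with $W$ a standard $\mathbb{R}^d$-valued Brownian motion). *)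

theory Defs
  imports "HOL-Analysis.Analysis"
begin

text \<open>
  \<open>'b L2\<close> is the Hilbert space of square-integrable functions on the real line with values in a
  Euclidean space, modulo equality almost everywhere.
  A type cannot depend on the real number \<open>T\<close>, so the space of square-integrable functions on
  \<open>(0,T)\<close> appears below as the subspace \<open>L2_on T\<close>, embedded by extension by zero.
\<close>

definition sq_integrable :: "(real \<Rightarrow> 'b::euclidean_space) \<Rightarrow> bool" where
  "sq_integrable f \<longleftrightarrow> f \<in> borel_measurable lborel \<and> integrable lborel (\<lambda>x. (norm (f x))\<^sup>2)"

lemma sq_integrable_measurable: "sq_integrable f \<Longrightarrow> f \<in> borel_measurable borel"
  by (simp add: sq_integrable_def)

lemma sq_integrable_inner:
  fixes f g :: "real \<Rightarrow> 'b::euclidean_space"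
  assumes "sq_integrable f" "sq_integrable g"
  shows "integrable lborel (\<lambda>x. f x \<bullet> g x)"
proof (rule Bochner_Integration.integrable_bound)
  show "integrable lborel (\<lambda>x. (norm (f x))\<^sup>2 + (norm (g x))\<^sup>2)"
    using assms by (simp add: sq_integrable_def)
  show "(\<lambda>x. f x \<bullet> g x) \<in> borel_measurable lborel"
    using assms unfolding sq_integrable_def by (intro borel_measurable_inner) blast+
  have "\<bar>f x \<bullet> g x\<bar> \<le> (norm (f x))\<^sup>2 + (norm (g x))\<^sup>2" for x
  proof -
    have "\<bar>f x \<bullet> g x\<bar> \<le> norm (f x) * norm (g x)"
      by (rule Cauchy_Schwarz_ineq2)
    also have "\<dots> \<le> (norm (f x))\<^sup>2 + (norm (g x))\<^sup>2"
    proof -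
      have "a * b \<le> a\<^sup>2 + b\<^sup>2" if "0 \<le> a" "0 \<le> b" for a b :: real
      proof -
        have "0 \<le> a * b"
          using that by simp
        with sum_squares_bound[of a b] show ?thesis
          by linarith
      qed
      then show ?thesis
        by simp
    qed
    finally show ?thesis .
  qed
  then show "AE x in lborel. norm (f x \<bullet> g x) \<le> norm ((norm (f x))\<^sup>2 + (norm (g x))\<^sup>2)"
    by auto
qed

lemma sq_integrable_zero: "sq_integrable (\<lambda>_. 0)"
  by (simp add: sq_integrable_def)

lemma sq_integrable_scaleR: "sq_integrable f \<Longrightarrow> sq_integrable (\<lambda>x. c *\<^sub>R f x)"
  by (auto simp: sq_integrable_def power_mult_distrib)

lemma sq_integrable_add:
  fixes f g :: "real \<Rightarrow> 'b::euclidean_space"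
  assumes "sq_integrable f" "sq_integrable g"
  shows "sq_integrable (\<lambda>x. f x + g x)"
proof -
  have eq: "(\<lambda>x. (norm (f x + g x))\<^sup>2) =
      (\<lambda>x. (norm (f x))\<^sup>2 + 2 * (f x \<bullet> g x) + (norm (g x))\<^sup>2)"
    by (rule ext) (simp add: power2_norm_eq_inner inner_add_left inner_add_right inner_commute)
  have "integrable lborel (\<lambda>x. (norm (f x + g x))\<^sup>2)"
    unfolding eq
    using assms sq_integrable_inner[OF assms]
    by (intro Bochner_Integration.integrable_add integrable_mult_right) (simp_all add: sq_integrable_def)
  moreover have "(\<lambda>x. f x + g x) \<in> borel_measurable lborel"
    using assms unfolding sq_integrable_def by (intro borel_measurable_add) blast+
  ultimately show ?thesis
    by (simp add: sq_integrable_def)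
qed

definition L2_rel :: "(real \<Rightarrow> 'b::euclidean_space) \<Rightarrow> (real \<Rightarrow> 'b) \<Rightarrow> bool" where
  "L2_rel f g \<longleftrightarrow> sq_integrable f \<and> sq_integrable g \<and> (AE x in lborel. f x = g x)"

quotient_type (overloaded) 'b L2 = "real \<Rightarrow> 'b::euclidean_space" / partial: L2_rel
proof (rule part_equivpI)
  show "\<exists>f :: real \<Rightarrow> 'b. L2_rel f f"
    by (rule exI[of _ "\<lambda>_. 0"]) (simp add: L2_rel_def sq_integrable_zero)
  show "symp (L2_rel :: (real \<Rightarrow> 'b) \<Rightarrow> _)"
    by (rule sympI) (simp add: L2_rel_def eq_commute)
  show "transp (L2_rel :: (real \<Rightarrow> 'b) \<Rightarrow> _)"
  proof (rule transpI)
    fix f g h :: "real \<Rightarrow> 'b"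
    assume *: "L2_rel f g" "L2_rel g h"
    then have "AE x in lborel. f x = g x" "AE x in lborel. g x = h x"
      by (auto simp: L2_rel_def)
    then have "AE x in lborel. f x = h x"
      by eventually_elim simp
    with * show "L2_rel f h"
      by (simp add: L2_rel_def)
  qed
qed

instantiation L2 :: (euclidean_space) real_vector
begin

lift_definition zero_L2 :: "'a L2" is "\<lambda>_. 0"
  by (simp add: L2_rel_def sq_integrable_zero)

lift_definition plus_L2 :: "'a L2 \<Rightarrow> 'a L2 \<Rightarrow> 'a L2" is "\<lambda>f g x. f x + g x"
  by (auto simp: L2_rel_def sq_integrable_add)

lift_definition scaleR_L2 :: "real \<Rightarrow> 'a L2 \<Rightarrow> 'a L2" is "\<lambda>c f x. c *\<^sub>R f x"
  by (auto simp: L2_rel_def sq_integrable_scaleR)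

definition uminus_L2 :: "'a L2 \<Rightarrow> 'a L2" where "uminus_L2 f = (-1) *\<^sub>R f"

definition minus_L2 :: "'a L2 \<Rightarrow> 'a L2 \<Rightarrow> 'a L2" where "minus_L2 f g = f + (- g)"

instance
proof
  fix f g h :: "'a L2" and a b :: real
  show "f + g + h = f + (g + h)"
    by transfer (auto simp: L2_rel_def add.assoc intro!: sq_integrable_add)
  show "f + g = g + f"
    by transfer (auto simp: L2_rel_def add.commute intro!: sq_integrable_add)
  show "0 + f = f"
    by transfer (auto simp: L2_rel_def)
  show "- f + f = 0"
    unfolding uminus_L2_def
    by transfer (auto simp: L2_rel_def sq_integrable_zero)
  show "f - g = f + - g"
    by (simp add: minus_L2_def)
  show "a *\<^sub>R (f + g) = a *\<^sub>R f + a *\<^sub>R g"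
    by transfer (auto simp: L2_rel_def scaleR_add_right intro!: sq_integrable_add sq_integrable_scaleR)
  show "(a + b) *\<^sub>R f = a *\<^sub>R f + b *\<^sub>R f"
    by transfer (auto simp: L2_rel_def scaleR_add_left intro!: sq_integrable_add sq_integrable_scaleR)
  show "a *\<^sub>R b *\<^sub>R f = (a * b) *\<^sub>R f"
    by transfer (auto simp: L2_rel_def intro!: sq_integrable_scaleR)
  show "1 *\<^sub>R f = f"
    by transfer (auto simp: L2_rel_def)
qed

end

instantiation L2 :: (euclidean_space) real_inner
begin

lift_definition inner_L2 :: "'a L2 \<Rightarrow> 'a L2 \<Rightarrow> real" is "\<lambda>f g. \<integral>x. f x \<bullet> g x \<partial>lborel"
  by (rule integral_cong_AE) (auto simp: L2_rel_def sq_integrable_def)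

definition norm_L2 :: "'a L2 \<Rightarrow> real" where "norm_L2 f = sqrt (f \<bullet> f)"

definition dist_L2 :: "'a L2 \<Rightarrow> 'a L2 \<Rightarrow> real" where "dist_L2 f g = norm (f - g)"

definition sgn_L2 :: "'a L2 \<Rightarrow> 'a L2" where "sgn_L2 f = inverse (norm f) *\<^sub>R f"

definition uniformity_L2 :: "('a L2 \<times> 'a L2) filter" where
  "uniformity_L2 = (INF e\<in>{0<..}. principal {(f, g). dist f g < e})"

definition open_L2 :: "'a L2 set \<Rightarrow> bool" where
  "open_L2 U \<longleftrightarrow> (\<forall>f\<in>U. \<forall>\<^sub>F (f', g) in uniformity. f' = f \<longrightarrow> g \<in> U)"

instance
proof
  fix f g h :: "'a L2" and a :: real and U :: "'a L2 set"
  show "dist f g = norm (f - g)"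
    by (simp add: dist_L2_def)
  show "sgn f = inverse (norm f) *\<^sub>R f"
    by (simp add: sgn_L2_def)
  show "uniformity = (INF e\<in>{0<..}. principal {(f :: 'a L2, g). dist f g < e})"
    by (simp add: uniformity_L2_def)
  show "open U = (\<forall>f\<in>U. \<forall>\<^sub>F (f', g) in uniformity. f' = f \<longrightarrow> g \<in> U)"
    by (simp add: open_L2_def)
  show "f \<bullet> g = g \<bullet> f"
    by transfer (simp add: inner_commute)
  show "(f + g) \<bullet> h = f \<bullet> h + g \<bullet> h"
    by transfer (simp add: L2_rel_def inner_add_left sq_integrable_inner)
  show "(a *\<^sub>R f) \<bullet> g = a * (f \<bullet> g)"
    by transfer simp
  show "0 \<le> f \<bullet> f"
    by transfer simp
  show "norm f = sqrt (f \<bullet> f)"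
    by (simp add: norm_L2_def)
  show "f \<bullet> f = 0 \<longleftrightarrow> f = 0"
  proof transfer
    fix f :: "real \<Rightarrow> 'a"
    assume "L2_rel f f"
    then have f: "sq_integrable f"
      by (simp add: L2_rel_def)
    have "(\<integral>x. f x \<bullet> f x \<partial>lborel) = 0 \<longleftrightarrow> (AE x in lborel. f x \<bullet> f x = 0)"
      by (rule integral_nonneg_eq_0_iff_AE) (auto simp: sq_integrable_inner f)
    also have "\<dots> \<longleftrightarrow> L2_rel f (\<lambda>_. 0)"
      by (auto simp: L2_rel_def f sq_integrable_zero)
    finally show "(\<integral>x. f x \<bullet> f x \<partial>lborel) = 0 \<longleftrightarrow> L2_rel f (\<lambda>_. 0)" .
  qed
qed

end

lemma sq_integrable_rep_L2: "sq_integrable (rep_L2 f)"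
  using Quotient3_rep_reflp[OF Quotient3_L2, of f] by (simp add: L2_rel_def)

lemma abs_rep_L2: "abs_L2 (rep_L2 f) = f"
  by (rule Quotient3_abs_rep[OF Quotient3_L2])

lemma rep_abs_L2:
  assumes "sq_integrable f" shows "AE x in lborel. rep_L2 (abs_L2 f) x = f x"
  using Quotient3_rep_abs[OF Quotient3_L2, of f] assms by (simp add: L2_rel_def)

lemma L2_eq_iff: "f = g \<longleftrightarrow> (AE x in lborel. rep_L2 f x = rep_L2 g x)"
  using Quotient3_rel_rep[OF Quotient3_L2, of f g] sq_integrable_rep_L2[of f] sq_integrable_rep_L2[of g]
  by (auto simp: L2_rel_def)

lemma rep_plus_L2: "AE x in lborel. rep_L2 (f + g) x = rep_L2 f x + rep_L2 g x"
  unfolding plus_L2_def map_fun_def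
  using rep_abs_L2[OF sq_integrable_add[OF sq_integrable_rep_L2[of f] sq_integrable_rep_L2[of g]]]
  by simp

lemma rep_scaleR_L2: "AE x in lborel. rep_L2 (c *\<^sub>R f) x = c *\<^sub>R rep_L2 f x"
  unfolding scaleR_L2_def map_fun_def
  using rep_abs_L2[OF sq_integrable_scaleR[OF sq_integrable_rep_L2[of f]]]
  by simp

lemma rep_minus_L2: "AE x in lborel. rep_L2 (f - g) x = rep_L2 f x - rep_L2 g x"
proof -
  have "f - g = f + (-1) *\<^sub>R g" by simp
  then show ?thesis
    using rep_plus_L2[of f "(-1) *\<^sub>R g"] rep_scaleR_L2[of "-1" g] by auto
qed

lemma rep_zero_L2: "AE x in lborel. rep_L2 0 x = 0"
  unfolding zero_L2_def using rep_abs_L2[OF sq_integrable_zero] by simp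

lemma inner_L2_eq: "f \<bullet> g = (\<integral>x. rep_L2 f x \<bullet> rep_L2 g x \<partial>lborel)" for f g :: "'b::euclidean_space L2"
  by (simp add: inner_L2_def)

lemma power2_norm_L2_eq: "(norm f)\<^sup>2 = (\<integral>x. (norm (rep_L2 f x))\<^sup>2 \<partial>lborel)" for f :: "'b::euclidean_space L2"
  by (simp add: power2_norm_eq_inner inner_L2_eq)

lemma abs_L2_add: "sq_integrable f \<Longrightarrow> sq_integrable g \<Longrightarrow> abs_L2 (\<lambda>x. f x + g x) = abs_L2 f + abs_L2 g"
  by (simp add: plus_L2.abs_eq L2_rel_def)

lemma abs_L2_scaleR: "sq_integrable f \<Longrightarrow> abs_L2 (\<lambda>x. c *\<^sub>R f x) = c *\<^sub>R abs_L2 f"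
  by (simp add: scaleR_L2.abs_eq L2_rel_def)

lemma inner_abs_L2: "sq_integrable f \<Longrightarrow> sq_integrable g \<Longrightarrow>
   abs_L2 f \<bullet> abs_L2 g = (\<integral>x. f x \<bullet> g x \<partial>lborel)"
  by (simp add: inner_L2.abs_eq L2_rel_def)

lemma nn_integral_L2: 
  "(\<integral>\<^sup>+x. ennreal ((norm (rep_L2 f x))\<^sup>2) \<partial>lborel) = ennreal ((norm f)\<^sup>2)" for f :: "'b::euclidean_space L2"
  unfolding power2_norm_L2_eq
  by (rule nn_integral_eq_integral) (use sq_integrable_rep_L2[of f] in \<open>auto simp: sq_integrable_def\<close>)

lemma L2_Cauchy_fast:
  fixes X :: "nat \<Rightarrow> 'b::euclidean_space L2"
  assumes X: "\<And>n. norm (X (Suc n) - X n) \<le> (1/2) ^ n"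
  shows "AE x in lborel. convergent (\<lambda>n. rep_L2 (X n) x)"
proof -
  define F where "F n x = rep_L2 (X n) x" for n x
  have F_meas[measurable]: "F n \<in> borel_measurable borel" for n
    using sq_integrable_measurable[OF sq_integrable_rep_L2[of "X n"]] by (simp add: F_def[abs_def])
  have pow_half: "(2::real) ^ n * (1/2) ^ n = 1" for n
    by (simp add: power_mult_distrib[symmetric])
  have *: "(\<integral>\<^sup>+x. ennreal (2 ^ n * (norm (F (Suc n) x - F n x))\<^sup>2) \<partial>lborel) \<le> ennreal ((1/2) ^ n)" for n
  proof -
    have "(\<integral>\<^sup>+x. ennreal (2 ^ n * (norm (F (Suc n) x - F n x))\<^sup>2) \<partial>lborel) =
        ennreal (2 ^ n) * (\<integral>\<^sup>+x. ennreal ((norm (F (Suc n) x - F n x))\<^sup>2) \<partial>lborel)"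
      by (simp add: ennreal_mult nn_integral_cmult)
    also have "(\<integral>\<^sup>+x. ennreal ((norm (F (Suc n) x - F n x))\<^sup>2) \<partial>lborel) =
        (\<integral>\<^sup>+x. ennreal ((norm (rep_L2 (X (Suc n) - X n) x))\<^sup>2) \<partial>lborel)"
    proof (rule nn_integral_cong_AE)
      show "AE x in lborel. ennreal ((norm (F (Suc n) x - F n x))\<^sup>2) =
          ennreal ((norm (rep_L2 (X (Suc n) - X n) x))\<^sup>2)"
        using rep_minus_L2[of "X (Suc n)" "X n"] by eventually_elim (simp add: F_def)
    qed
    also have "\<dots> = ennreal ((norm (X (Suc n) - X n))\<^sup>2)"
      by (rule nn_integral_L2)
    also have "ennreal (2 ^ n) * \<dots> = ennreal (2 ^ n * (norm (X (Suc n) - X n))\<^sup>2)"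
      by (simp add: ennreal_mult)
    also have "\<dots> \<le> ennreal ((1/2) ^ n)"
    proof (rule ennreal_leI)
      have "(norm (X (Suc n) - X n))\<^sup>2 \<le> ((1/2) ^ n)\<^sup>2"
        using X by (intro power_mono) auto
      then have "2 ^ n * (norm (X (Suc n) - X n))\<^sup>2 \<le> 2 ^ n * ((1/2) ^ n)\<^sup>2"
        by (intro mult_left_mono) auto
      also have "\<dots> = (2 ^ n * (1/2) ^ n) * (1/2) ^ n"
        by (simp only: power2_eq_square mult.assoc)
      also have "\<dots> = (1/2) ^ n"
        by (simp only: pow_half mult_1_left mult_1_right)
      finally show "2 ^ n * (norm (X (Suc n) - X n))\<^sup>2 \<le> (1/2) ^ n" .
    qed
    finally show ?thesis .
  qed
  have "(\<integral>\<^sup>+x. (\<Sum>n. ennreal (2 ^ n * (norm (F (Suc n) x - F n x))\<^sup>2)) \<partial>lborel) =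
      (\<Sum>n. \<integral>\<^sup>+x. ennreal (2 ^ n * (norm (F (Suc n) x - F n x))\<^sup>2) \<partial>lborel)"
    by (rule nn_integral_suminf) simp
  also have "\<dots> \<le> (\<Sum>n. ennreal ((1/2) ^ n))"
    by (intro suminf_le * allI) auto
  also have "\<dots> = ennreal (\<Sum>n. (1/2) ^ n)"
    by (intro suminf_ennreal2) auto
  also have "\<dots> < \<infinity>"
    by simp
  finally have "AE x in lborel. (\<Sum>n. ennreal (2 ^ n * (norm (F (Suc n) x - F n x))\<^sup>2)) \<noteq> \<infinity>"
    by (intro nn_integral_PInf_AE) (auto simp: less_top)
  then show ?thesis
  proof eventually_elim
    case (elim x)
    define a where "a n = norm (F (Suc n) x - F n x)" for n
    have a0: "0 \<le> a n" for n
      by (simp add: a_def)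
    have "summable (\<lambda>n. 2 ^ n * (a n)\<^sup>2)"
      using elim by (intro summable_suminf_not_top) (auto simp: a_def)
    moreover have "summable (\<lambda>n. (1/2::real) ^ n)"
      by simp
    ultimately have "summable (\<lambda>n. 2 ^ n * (a n)\<^sup>2 + (1/2) ^ n)"
      by (rule summable_add)
    moreover have "a n \<le> 2 ^ n * (a n)\<^sup>2 + (1/2) ^ n" for n
    proof -
      have "0 \<le> 2 ^ n * (a n - (1/2) ^ n)\<^sup>2"
        by simp
      also have "\<dots> = 2 ^ n * (a n)\<^sup>2 + (2 ^ n * (1/2) ^ n) * (1/2) ^ n - 2 * (2 ^ n * (1/2) ^ n) * a n"
        by (simp only: power2_diff power2_eq_square) (simp only: algebra_simps)
      also have "\<dots> = 2 ^ n * (a n)\<^sup>2 + (1/2) ^ n - 2 * a n"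
        by (simp only: pow_half mult_1_left mult_1_right)
      finally show ?thesis
        using a0[of n] by linarith
    qed
    ultimately have "summable a"
      using a0 by (intro summable_comparison_test'[where N = 0 and f = a]) auto
    then have "summable (\<lambda>n. F (Suc n) x - F n x)"
      unfolding a_def by (rule summable_norm_cancel)
    then have "convergent (\<lambda>n. \<Sum>i<n. F (Suc i) x - F i x)"
      by (simp add: summable_iff_convergent)
    then have "convergent (\<lambda>n. F n x - F 0 x)"
      by (simp only: sum_lessThan_telescope[where f = "\<lambda>n. F n x"])
    then have "convergent (\<lambda>n. (F n x - F 0 x) + F 0 x)"
      by (intro convergent_add convergent_const)
    then show ?case
      by (simp add: F_def)
  qed
qed

lemma L2_complete_fast:
  fixes X :: "nat \<Rightarrow> 'b::euclidean_space L2"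
  assumes X: "\<And>n. norm (X (Suc n) - X n) \<le> (1/2) ^ n" and "Cauchy X"
  shows "convergent X"
proof -
  define F where "F n x = rep_L2 (X n) x" for n x
  have F_meas[measurable]: "F n \<in> borel_measurable borel" for n
    using sq_integrable_measurable[OF sq_integrable_rep_L2[of "X n"]] by (simp add: F_def[abs_def])
  define f where "f x = lim (\<lambda>n. F n x)" for x
  have f_meas[measurable]: "f \<in> borel_measurable borel"
    unfolding f_def by measurable
  have lim: "AE x in lborel. (\<lambda>n. F n x) \<longlonglongrightarrow> f x"
    using L2_Cauchy_fast[OF X] unfolding F_def f_def
    by eventually_elim (simp add: convergent_LIMSEQ_iff)
  have bound: "(\<integral>\<^sup>+x. ennreal ((norm (f x - F n x))\<^sup>2) \<partial>lborel) \<le> ennreal (e\<^sup>2)"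
    if "\<And>m. m \<ge> n \<Longrightarrow> norm (X m - X n) \<le> e" for n e
  proof -
    have "AE x in lborel. ennreal ((norm (f x - F n x))\<^sup>2) =
        liminf (\<lambda>m. ennreal ((norm (F m x - F n x))\<^sup>2))"
      using lim
    proof eventually_elim
      case (elim x)
      then have "(\<lambda>m. ennreal ((norm (F m x - F n x))\<^sup>2)) \<longlonglongrightarrow> ennreal ((norm (f x - F n x))\<^sup>2)"
        by (intro tendsto_intros)
      then show ?case
        by (rule lim_imp_Liminf[OF sequentially_bot, symmetric])
    qed
    then have "(\<integral>\<^sup>+x. ennreal ((norm (f x - F n x))\<^sup>2) \<partial>lborel) =
        (\<integral>\<^sup>+x. liminf (\<lambda>m. ennreal ((norm (F m x - F n x))\<^sup>2)) \<partial>lborel)"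
      by (rule nn_integral_cong_AE)
    also have "\<dots> \<le> liminf (\<lambda>m. \<integral>\<^sup>+x. ennreal ((norm (F m x - F n x))\<^sup>2) \<partial>lborel)"
      by (rule nn_integral_liminf) simp
    also have "\<dots> \<le> liminf (\<lambda>m. ennreal (e\<^sup>2))"
    proof (rule Liminf_mono)
      show "\<forall>\<^sub>F m in sequentially. (\<integral>\<^sup>+x. ennreal ((norm (F m x - F n x))\<^sup>2) \<partial>lborel) \<le> ennreal (e\<^sup>2)"
        using eventually_ge_at_top[of n]
      proof eventually_elim
        case (elim m)
        have "(\<integral>\<^sup>+x. ennreal ((norm (F m x - F n x))\<^sup>2) \<partial>lborel) =
            (\<integral>\<^sup>+x. ennreal ((norm (rep_L2 (X m - X n) x))\<^sup>2) \<partial>lborel)"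
          by (rule nn_integral_cong_AE)
            (use rep_minus_L2[of "X m" "X n"] in \<open>eventually_elim, simp add: F_def\<close>)
        also have "\<dots> = ennreal ((norm (X m - X n))\<^sup>2)"
          by (rule nn_integral_L2)
        also have "\<dots> \<le> ennreal (e\<^sup>2)"
          using that[OF elim] by (intro ennreal_leI power_mono) auto
        finally show ?case .
      qed
    qed
    also have "\<dots> = ennreal (e\<^sup>2)"
      by (simp add: Liminf_const)
    finally show ?thesis .
  qed
  have sq: "sq_integrable (\<lambda>x. f x - F n x)" if "\<And>m. m \<ge> n \<Longrightarrow> norm (X m - X n) \<le> e" for n e
    unfolding sq_integrable_def
  proof (intro conjI integrableI_bounded)
    show "(\<integral>\<^sup>+x. ennreal (norm ((norm (f x - F n x))\<^sup>2)) \<partial>lborel) < \<infinity>"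
      using le_less_trans[OF bound[OF that] ennreal_less_top] by simp
  qed simp_all
  have ex: "\<exists>n0. \<forall>n\<ge>n0. \<forall>m\<ge>n. norm (X m - X n) \<le> e" if e: "e > 0" for e
  proof -
    obtain M where "\<forall>m\<ge>M. \<forall>n\<ge>M. norm (X m - X n) < e"
      using CauchyD[OF \<open>Cauchy X\<close> e] by blast
    then show ?thesis
      by (intro exI[of _ M]) (auto intro!: less_imp_le)
  qed
  obtain n1 where n1: "\<forall>m\<ge>n1. norm (X m - X n1) \<le> 1"
    using ex[of 1] by auto
  have "sq_integrable (\<lambda>x. (f x - F n1 x) + F n1 x)"
    using sq[of n1 1] n1 sq_integrable_rep_L2[of "X n1"] unfolding F_def
    by (intro sq_integrable_add) auto
  then have sq_f: "sq_integrable f"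
    by simp
  have "X \<longlonglongrightarrow> abs_L2 f"
  proof (rule LIMSEQ_I)
    fix r :: real
    assume "0 < r"
    then obtain n0 where n0: "\<forall>n\<ge>n0. \<forall>m\<ge>n. norm (X m - X n) \<le> r / 2"
      using ex[of "r / 2"] by auto
    show "\<exists>no. \<forall>n\<ge>no. norm (X n - abs_L2 f) < r"
    proof (intro exI allI impI)
      fix n
      assume "n0 \<le> n"
      have "ennreal ((norm (abs_L2 f - X n))\<^sup>2) = (\<integral>\<^sup>+x. ennreal ((norm (rep_L2 (abs_L2 f - X n) x))\<^sup>2) \<partial>lborel)"
        by (rule nn_integral_L2[symmetric])
      also have "\<dots> = (\<integral>\<^sup>+x. ennreal ((norm (f x - F n x))\<^sup>2) \<partial>lborel)"
        by (rule nn_integral_cong_AE)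
          (use rep_minus_L2[of "abs_L2 f" "X n"] rep_abs_L2[OF sq_f] in \<open>eventually_elim, simp add: F_def\<close>)
      also have "\<dots> \<le> ennreal ((r/2)\<^sup>2)"
        using n0 \<open>n0 \<le> n\<close> by (intro bound) auto
      finally have "(norm (abs_L2 f - X n))\<^sup>2 \<le> (r/2)\<^sup>2"
        by (simp only: ennreal_le_iff zero_le_power2)
      then have "norm (abs_L2 f - X n) \<le> r/2"
        by (rule power2_le_imp_le) (use \<open>0 < r\<close> in linarith)
      then show "norm (X n - abs_L2 f) < r"
        using \<open>0 < r\<close> by (simp add: norm_minus_commute)
    qed
  qed
  then show ?thesis
    by (rule convergentI)
qed

instance L2 :: (euclidean_space) complete_space
proof
  fix X :: "nat \<Rightarrow> 'a L2"
  assume X: "Cauchy X"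
  have "\<exists>N. \<forall>m\<ge>N. \<forall>n\<ge>N. norm (X m - X n) < (1/2) ^ k" for k
    using CauchyD[OF X, of "(1/2) ^ k"] by auto
  then obtain N where N: "\<And>k m n. m \<ge> N k \<Longrightarrow> n \<ge> N k \<Longrightarrow> norm (X m - X n) < (1/2) ^ k"
    by metis
  define r where "r = rec_nat (N 0) (\<lambda>k q. max (Suc q) (N (Suc k)))"
  have r_Suc: "r (Suc k) = max (Suc (r k)) (N (Suc k))" for k
    by (simp add: r_def)
  have r: "strict_mono r"
    by (simp add: strict_mono_Suc_iff r_Suc less_max_iff_disj)
  have r_N: "N k \<le> r k" for k
    by (cases k) (simp_all add: r_def)
  have "convergent (X \<circ> r)"
  proof (rule L2_complete_fast)
    show "Cauchy (X \<circ> r)"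
      using X r by (rule Cauchy_subseq_Cauchy)
    show "norm ((X \<circ> r) (Suc n) - (X \<circ> r) n) \<le> (1/2) ^ n" for n
    proof -
      have "N n \<le> r (Suc n)"
        using r_N[of n] strict_monoD[OF r, of n "Suc n"] by simp
      then show ?thesis
        using N[of n "r (Suc n)" "r n"] r_N[of n] by simp
    qed
  qed
  then obtain l where l: "(X \<circ> r) \<longlonglongrightarrow> l"
    by (auto simp: convergent_def)
  have "X \<longlonglongrightarrow> l"
  proof (rule LIMSEQ_I)
    fix e :: real
    assume "0 < e"
    obtain M where M: "\<forall>m\<ge>M. \<forall>n\<ge>M. norm (X m - X n) < e / 2"
      using CauchyD[OF X, of "e/2"] \<open>0 < e\<close> by auto
    obtain K where K: "\<forall>k\<ge>K. norm ((X \<circ> r) k - l) < e / 2"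
      using LIMSEQ_D[OF l, of "e/2"] \<open>0 < e\<close> by auto
    define k where "k = max M K"
    have "M \<le> r k"
      using seq_suble[OF r, of k] by (simp add: k_def)
    show "\<exists>no. \<forall>n\<ge>no. norm (X n - l) < e"
    proof (intro exI allI impI)
      fix n
      assume "M \<le> n"
      have "norm (X n - l) \<le> norm (X n - X (r k)) + norm (X (r k) - l)"
        using norm_triangle_ineq[of "X n - X (r k)" "X (r k) - l"] by simp
      also have "\<dots> < e / 2 + e / 2"
        using M \<open>M \<le> n\<close> \<open>M \<le> r k\<close> K by (intro add_strict_mono) (auto simp: k_def)
      finally show "norm (X n - l) < e"
        by simp
    qed
  qed
  then show "convergent X"
    by (rule convergentI)
qed

instance L2 :: (euclidean_space) banach ..

text \<open>
  \<open>rep_L2\<close> selects some representative of the class; all statements about it are made almost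
  everywhere, so they do not depend on the choice.
\<close>

definition L2_on :: "real \<Rightarrow> 'b::euclidean_space L2 set" where
  "L2_on T = {f. AE \<xi> in lborel. \<xi> \<notin> {0<..<T} \<longrightarrow> rep_L2 f \<xi> = 0}"

text \<open>Only the values of \<open>k2\<close> at positive arguments are used.\<close>

definition k2 :: "real \<Rightarrow> real \<Rightarrow> real" where
  "k2 \<alpha> t = t powr (\<alpha> - 1) / Gamma \<alpha>"

definition sigma_kernel :: "real \<Rightarrow> real \<Rightarrow> real \<Rightarrow> real \<Rightarrow> real" where
  "sigma_kernel \<alpha> T t \<xi> = (if \<xi> \<in> {0<..<T} \<and> t < \<xi> then k2 \<alpha> (\<xi> - t) else 0)"

text \<open>
  \<open>Blinfun\<close> is meaningful only on bounded linear maps; \<open>sigma_op_apply\<close> and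
  \<open>blinfun_adjoint_inner\<close> below show that this is the case here.
\<close>

definition sigma_op :: "real \<Rightarrow> real \<Rightarrow> real \<Rightarrow> 'b::euclidean_space \<Rightarrow>\<^sub>L 'b L2" where
  "sigma_op \<alpha> T t = Blinfun (\<lambda>x. abs_L2 (\<lambda>\<xi>. sigma_kernel \<alpha> T t \<xi> *\<^sub>R x))"

definition blinfun_adjoint :: "('a::real_inner \<Rightarrow>\<^sub>L 'c::real_inner) \<Rightarrow> 'c \<Rightarrow>\<^sub>L 'a" where
  "blinfun_adjoint A = Blinfun (adjoint (blinfun_apply A))"

text \<open>
  The integral is taken in the Banach space of bounded operators; its integrand is norm continuous
  (\<open>Q_op_integrable\<close>), so it is a Riemann and Bochner integral of operators.
  The adjoint is formed in the whole space \<open>'b L2\<close>: since \<open>sigma_op\<close> takes its values in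
  \<open>L2_on T\<close>, its restriction to \<open>L2_on T\<close> is the adjoint of \<open>sigma_op \<alpha> T \<tau>\<close> regarded as a map into
  \<open>L2_on T\<close>. Accordingly \<open>Q_op \<alpha> T t s\<close> maps into \<open>L2_on T\<close> (\<open>Q_op_in_L2_on\<close>), and the operator on
  square-integrable functions on \<open>(0,T)\<close> is its restriction to \<open>L2_on T\<close>.
\<close>

definition Q_op :: "real \<Rightarrow> real \<Rightarrow> real \<Rightarrow> real \<Rightarrow> 'b::euclidean_space L2 \<Rightarrow>\<^sub>L 'b L2" where
  "Q_op \<alpha> T t s = integral {T - t..T - s} (\<lambda>\<tau>. sigma_op \<alpha> T \<tau> o\<^sub>L blinfun_adjoint (sigma_op \<alpha> T \<tau>))"

lemma adjoint_euclidean_works: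
  fixes f :: "'a::euclidean_space \<Rightarrow> 'c::real_inner"
  assumes "linear f"
  shows "f x \<bullet> y = x \<bullet> adjoint f y"
proof -
  interpret linear f by fact
  have "f x \<bullet> y = x \<bullet> (\<Sum>b\<in>Basis. (f b \<bullet> y) *\<^sub>R b)" for x y
  proof -
    have "f x = (\<Sum>b\<in>Basis. (x \<bullet> b) *\<^sub>R f b)"
      using sum[of "\<lambda>b. (x \<bullet> b) *\<^sub>R b" Basis]
      by (simp only: euclidean_representation scale)
    then have "f x \<bullet> y = (\<Sum>b\<in>Basis. (x \<bullet> b) * (f b \<bullet> y))"
      by (simp only: inner_sum_left inner_scaleR_left)
    also have "\<dots> = x \<bullet> (\<Sum>b\<in>Basis. (f b \<bullet> y) *\<^sub>R b)"
      by (simp only: inner_sum_right inner_scaleR_right mult.commute)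
    finally show ?thesis .
  qed
  then have "\<exists>f'. \<forall>x y. f x \<bullet> y = x \<bullet> f' y"
    by (intro exI[of _ "\<lambda>y. \<Sum>b\<in>Basis. (f b \<bullet> y) *\<^sub>R b"] allI)
  from someI_ex[OF this] show ?thesis
    unfolding adjoint_def by blast
qed

lemma blinfun_adjoint_inner:
  fixes A :: "'a::euclidean_space \<Rightarrow>\<^sub>L 'c::real_inner"
  shows "A x \<bullet> y = x \<bullet> blinfun_adjoint A y"
    and "norm (blinfun_adjoint A) \<le> norm A"
proof -
  have lin: "linear (blinfun_apply A)"
    by (rule bounded_linear.linear[OF blinfun.bounded_linear_right])
  note adj = adjoint_euclidean_works[OF lin]
  have bound: "norm (adjoint A y) \<le> norm y * norm A" for y
  proof -
    have "norm (adjoint A y) * norm (adjoint A y) = A (adjoint A y) \<bullet> y"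
      unfolding adj power2_eq_square[symmetric] by (rule power2_norm_eq_inner)
    also have "\<dots> \<le> norm (A (adjoint A y)) * norm y"
      by (rule norm_cauchy_schwarz)
    also have "\<dots> \<le> (norm A * norm (adjoint A y)) * norm y"
      by (intro mult_right_mono norm_blinfun) simp
    finally have "norm (adjoint A y) * norm (adjoint A y) \<le> norm (adjoint A y) * (norm y * norm A)"
      by (simp add: mult_ac)
    then show ?thesis
      by (cases "norm (adjoint A y) = 0") (simp_all add: mult_le_cancel_left)
  qed
  have bl: "bounded_linear (adjoint A)"
  proof (rule bounded_linear_intro[OF _ _ bound])
    show "adjoint A (y + z) = adjoint A y + adjoint A z" for y z
      by (rule vector_eq_ldot[THEN iffD1]) (simp add: inner_add_right flip: adj)
    show "adjoint A (c *\<^sub>R y) = c *\<^sub>R adjoint A y" for c y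
      by (rule vector_eq_ldot[THEN iffD1]) (simp flip: adj)
  qed
  have app: "blinfun_apply (blinfun_adjoint A) = adjoint A"
    unfolding blinfun_adjoint_def by (rule bounded_linear_Blinfun_apply[OF bl])
  show "A x \<bullet> y = x \<bullet> blinfun_adjoint A y"
    by (simp add: app adj)
  show "norm (blinfun_adjoint A) \<le> norm A"
    by (rule norm_blinfun_bound) (use bound in \<open>simp_all add: app mult.commute\<close>)
qed

lemma blinfun_adjoint_diff:
  fixes A B :: "'a::euclidean_space \<Rightarrow>\<^sub>L 'c::real_inner"
  shows "blinfun_adjoint (A - B) = blinfun_adjoint A - blinfun_adjoint B"
proof (rule blinfun_eqI)
  fix y
  show "blinfun_adjoint (A - B) y = (blinfun_adjoint A - blinfun_adjoint B) y"
    by (rule vector_eq_ldot[THEN iffD1])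
      (simp add: blinfun.diff_left inner_diff_right inner_diff_left flip: blinfun_adjoint_inner(1))
qed

lemma k2_measurable[measurable]: "k2 \<alpha> \<in> borel_measurable borel"
  unfolding k2_def[abs_def] by measurable

lemma sigma_kernel_measurable[measurable]: "sigma_kernel \<alpha> T t \<in> borel_measurable borel"
  unfolding sigma_kernel_def[abs_def] by measurable

lemma nn_integral_k2_sq:
  assumes "1/2 < \<alpha>" "a \<le> b"
  shows "(\<integral>\<^sup>+\<xi>. ennreal (indicator {a<..b} \<xi> * (k2 \<alpha> (\<xi> - a))\<^sup>2) \<partial>lborel) =
    ennreal ((b - a) powr (2 * \<alpha> - 1) / ((2 * \<alpha> - 1) * (Gamma \<alpha>)\<^sup>2))"
proof -
  define c where "c = b - a"
  have c: "0 \<le> c" "b = a + c"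
    using assms by (simp_all add: c_def)
  have eq: "indicator {a<..b} (a + 1 * x) * (k2 \<alpha> (a + 1 * x - a))\<^sup>2 =
      indicator {0..c} x * (x powr (2 * \<alpha> - 2) * inverse ((Gamma \<alpha>)\<^sup>2))" for x
  proof (cases "0 < x \<and> x \<le> c")
    case True
    have "(x powr (\<alpha> - 1))\<^sup>2 = x powr (2 * \<alpha> - 2)"
      using True by (simp add: power2_eq_square powr_add[symmetric])
    then show ?thesis
      using True by (simp add: c k2_def divide_inverse power_mult_distrib power_inverse)
  next
    case False
    then show ?thesis
      by (cases "x = 0") (auto simp: c indicator_def)
  qed
  have "((\<lambda>x. x powr (2 * \<alpha> - 2)) has_integral (c powr (2 * \<alpha> - 2 + 1) / (2 * \<alpha> - 2 + 1))) {0..c}"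
    using assms c by (intro has_integral_powr_from_0) auto
  then have "((\<lambda>x. x powr (2 * \<alpha> - 2) * inverse ((Gamma \<alpha>)\<^sup>2)) has_integral
      (c powr (2 * \<alpha> - 2 + 1) / (2 * \<alpha> - 2 + 1) * inverse ((Gamma \<alpha>)\<^sup>2))) {0..c}"
    by (rule has_integral_mult_left)
  then have "(\<integral>\<^sup>+x. ennreal (indicator {0..c} x * (x powr (2 * \<alpha> - 2) * inverse ((Gamma \<alpha>)\<^sup>2))) \<partial>lborel) =
      ennreal (c powr (2 * \<alpha> - 2 + 1) / (2 * \<alpha> - 2 + 1) * inverse ((Gamma \<alpha>)\<^sup>2))"
    by (rule nn_integral_has_integral_lebesgue[rotated]) simp
  moreover have "c powr (2 * \<alpha> - 2 + 1) / (2 * \<alpha> - 2 + 1) * inverse ((Gamma \<alpha>)\<^sup>2) =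
      (b - a) powr (2 * \<alpha> - 1) / ((2 * \<alpha> - 1) * (Gamma \<alpha>)\<^sup>2)"
  proof -
    have "2 * \<alpha> - 2 + 1 = 2 * \<alpha> - 1"
      by simp
    then show ?thesis
      by (simp only: c_def divide_inverse inverse_mult_distrib mult.assoc)
  qed
  moreover have "(\<integral>\<^sup>+\<xi>. ennreal (indicator {a<..b} \<xi> * (k2 \<alpha> (\<xi> - a))\<^sup>2) \<partial>lborel) =
      (\<integral>\<^sup>+x. ennreal (indicator {a<..b} (a + 1 * x) * (k2 \<alpha> (a + 1 * x - a))\<^sup>2) \<partial>lborel)"
    by (subst nn_integral_real_affine[of _ 1 a]) simp_all
  ultimately show ?thesis
    by (simp only: eq)
qed

lemma sq_integrable_sigma_kernel:
  assumes "1/2 < \<alpha>"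
  shows "sq_integrable (\<lambda>\<xi>. sigma_kernel \<alpha> T t \<xi> *\<^sub>R (x :: 'b::euclidean_space))"
proof -
  have "sq_integrable (sigma_kernel \<alpha> T t)"
    unfolding sq_integrable_def
  proof (intro conjI integrableI_bounded)
    have "(\<integral>\<^sup>+\<xi>. ennreal (norm ((norm (sigma_kernel \<alpha> T t \<xi>))\<^sup>2)) \<partial>lborel) \<le>
        (\<integral>\<^sup>+\<xi>. ennreal (indicator {t<..max t T} \<xi> * (k2 \<alpha> (\<xi> - t))\<^sup>2) \<partial>lborel)"
      by (intro nn_integral_mono ennreal_leI) (auto simp: sigma_kernel_def indicator_def)
    also have "\<dots> < \<infinity>"
      by (subst nn_integral_k2_sq[OF assms]) simp_all
    finally show "(\<integral>\<^sup>+\<xi>. ennreal (norm ((norm (sigma_kernel \<alpha> T t \<xi>))\<^sup>2)) \<partial>lborel) < \<infinity>" .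
  qed simp_all
  then show ?thesis
    by (auto simp: sq_integrable_def power_mult_distrib)
qed

lemma norm_abs_L2_scaleR:
  assumes "sq_integrable (k :: real \<Rightarrow> real)"
  shows "norm (abs_L2 (\<lambda>\<xi>. k \<xi> *\<^sub>R (x :: 'b::euclidean_space))) = sqrt (\<integral>\<xi>. (k \<xi>)\<^sup>2 \<partial>lborel) * norm x"
proof -
  have sq: "sq_integrable (\<lambda>\<xi>. k \<xi> *\<^sub>R x)"
    using assms by (auto simp: sq_integrable_def power_mult_distrib)
  have "abs_L2 (\<lambda>\<xi>. k \<xi> *\<^sub>R x) \<bullet> abs_L2 (\<lambda>\<xi>. k \<xi> *\<^sub>R x) = (\<integral>\<xi>. (k \<xi>)\<^sup>2 * (x \<bullet> x) \<partial>lborel)"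
    by (simp add: inner_abs_L2[OF sq sq] power2_eq_square mult.assoc)
  also have "\<dots> = (\<integral>\<xi>. (k \<xi>)\<^sup>2 \<partial>lborel) * (x \<bullet> x)"
    by simp
  finally show ?thesis
    by (simp add: norm_eq_sqrt_inner real_sqrt_mult)
qed

lemma sq_integrable_sigma_kernel_real:
  assumes "1/2 < \<alpha>" shows "sq_integrable (sigma_kernel \<alpha> T t)"
  using sq_integrable_sigma_kernel[OF assms, of T t "1::real"] by simp

lemma sigma_op_apply:
  assumes "1/2 < \<alpha>"
  shows "sigma_op \<alpha> T t x = abs_L2 (\<lambda>\<xi>. sigma_kernel \<alpha> T t \<xi> *\<^sub>R (x :: 'b::euclidean_space))"
proof -
  note sq = sq_integrable_sigma_kernel[OF assms]
  have "bounded_linear (\<lambda>x :: 'b. abs_L2 (\<lambda>\<xi>. sigma_kernel \<alpha> T t \<xi> *\<^sub>R x))"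
  proof (rule bounded_linear_intro)
    fix x y :: 'b and c :: real
    show "abs_L2 (\<lambda>\<xi>. sigma_kernel \<alpha> T t \<xi> *\<^sub>R (x + y)) =
        abs_L2 (\<lambda>\<xi>. sigma_kernel \<alpha> T t \<xi> *\<^sub>R x) + abs_L2 (\<lambda>\<xi>. sigma_kernel \<alpha> T t \<xi> *\<^sub>R y)"
      by (simp only: scaleR_add_right abs_L2_add[OF sq sq])
    show "abs_L2 (\<lambda>\<xi>. sigma_kernel \<alpha> T t \<xi> *\<^sub>R (c *\<^sub>R x)) =
        c *\<^sub>R abs_L2 (\<lambda>\<xi>. sigma_kernel \<alpha> T t \<xi> *\<^sub>R x)"
      by (simp only: scaleR_left_commute[of _ c] abs_L2_scaleR[OF sq])
    show "norm (abs_L2 (\<lambda>\<xi>. sigma_kernel \<alpha> T t \<xi> *\<^sub>R x)) \<le>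
        norm x * sqrt (\<integral>\<xi>. (sigma_kernel \<alpha> T t \<xi>)\<^sup>2 \<partial>lborel)"
      by (simp only: norm_abs_L2_scaleR[OF sq_integrable_sigma_kernel_real[OF assms]] mult.commute order_refl)
  qed
  then show ?thesis
    unfolding sigma_op_def by (simp only: bounded_linear_Blinfun_apply)
qed

lemma sigma_op_in_L2_on:
  assumes "1/2 < \<alpha>" shows "sigma_op \<alpha> T t x \<in> L2_on T"
  unfolding L2_on_def sigma_op_apply[OF assms] mem_Collect_eq
  using rep_abs_L2[OF sq_integrable_sigma_kernel[OF assms, of T t x]]
  by eventually_elim (auto simp: sigma_kernel_def)

lemma norm_sigma_op_diff_le:
  fixes \<alpha> T t t' :: real
  assumes \<alpha>: "1/2 < \<alpha>" "\<alpha> < 1" and t: "0 \<le> t" "t \<le> t'" "t' \<le> T"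
  defines "p \<equiv> 2 * \<alpha> - 1"
  defines "D \<equiv> p * (Gamma \<alpha>)\<^sup>2"
  shows "norm (sigma_op \<alpha> T t - sigma_op \<alpha> T t' :: 'b::euclidean_space \<Rightarrow>\<^sub>L 'b L2) \<le>
    sqrt (2 * (\<bar>t - t'\<bar> powr p / D))"
proof -
  let ?d = "\<lambda>\<xi>. sigma_kernel \<alpha> T t \<xi> - sigma_kernel \<alpha> T t' \<xi>"
  let ?g = "\<lambda>a b \<xi>. indicator {a<..b} \<xi> * (k2 \<alpha> (\<xi> - a))\<^sup>2"
  define N where "N = (\<integral>\<xi>. (?d \<xi>)\<^sup>2 \<partial>lborel)"
  have p: "0 < p"
    using \<alpha> by (simp add: p_def)
  have G: "0 < Gamma \<alpha>"
    using \<alpha> by (intro Gamma_real_pos) simp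
  have D: "0 < D"
    unfolding D_def by (rule mult_pos_pos[OF p zero_less_power[OF G]])
  have sq: "sq_integrable ?d"
    using sq_integrable_add[OF sq_integrable_sigma_kernel_real[OF \<alpha>(1), of T t]
      sq_integrable_scaleR[OF sq_integrable_sigma_kernel_real[OF \<alpha>(1), of T t'], of "-1"]]
    by simp
  then have int: "integrable lborel (\<lambda>\<xi>. (?d \<xi>)\<^sup>2)"
    by (simp add: sq_integrable_def)
  have pos: "0 \<le> N"
    unfolding N_def by simp
  have N: "ennreal N = (\<integral>\<^sup>+\<xi>. ennreal ((?d \<xi>)\<^sup>2) \<partial>lborel)"
    unfolding N_def by (rule nn_integral_eq_integral[symmetric]) (use int in auto)
  have mono: "0 \<le> k2 \<alpha> y \<and> k2 \<alpha> y \<le> k2 \<alpha> x" if "0 < x" "x \<le> y" for x y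
    using that \<alpha> Gamma_real_pos[of \<alpha>] unfolding k2_def
    by (auto intro!: divide_right_mono powr_mono2')
  have ptw: "(?d \<xi>)\<^sup>2 + ?g t T \<xi> \<le> 2 * ?g t t' \<xi> + ?g t' T \<xi>" for \<xi>
  proof (cases "t' < \<xi> \<and> \<xi> \<le> T")
    case True
    define u v where "u = k2 \<alpha> (\<xi> - t)" and "v = k2 \<alpha> (\<xi> - t')"
    have uv: "0 \<le> u" "u \<le> v"
      using mono[of "\<xi> - t'" "\<xi> - t"] True t by (auto simp: u_def v_def)
    have "u\<^sup>2 \<le> u * v"
      unfolding power2_eq_square using uv by (intro mult_left_mono) auto
    then have "(u - v)\<^sup>2 + u\<^sup>2 \<le> v\<^sup>2"
      by (simp add: power2_diff)
    moreover have "u\<^sup>2 \<le> v\<^sup>2"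
      using uv by (intro power_mono)
    ultimately show ?thesis
      using True t by (auto simp: sigma_kernel_def indicator_def u_def v_def)
  next
    case False
    then show ?thesis
      using t by (auto simp: sigma_kernel_def indicator_def)
  qed
  have "ennreal N + ennreal ((T - t) powr p / D) =
      (\<integral>\<^sup>+\<xi>. ennreal ((?d \<xi>)\<^sup>2) + ennreal (?g t T \<xi>) \<partial>lborel)"
    unfolding N p_def D_def nn_integral_k2_sq[OF \<alpha>(1) order_trans[OF t(2,3)], symmetric]
    by (rule nn_integral_add[symmetric]) simp_all
  also have "\<dots> \<le> (\<integral>\<^sup>+\<xi>. 2 * ennreal (?g t t' \<xi>) + ennreal (?g t' T \<xi>) \<partial>lborel)"
  proof (rule nn_integral_mono)
    fix \<xi>
    have "ennreal ((?d \<xi>)\<^sup>2) + ennreal (?g t T \<xi>) = ennreal ((?d \<xi>)\<^sup>2 + ?g t T \<xi>)"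
      by (rule ennreal_plus[symmetric]) simp_all
    also have "\<dots> \<le> ennreal (2 * ?g t t' \<xi> + ?g t' T \<xi>)"
      by (rule ennreal_leI[OF ptw])
    also have "\<dots> = ennreal (2 * ?g t t' \<xi>) + ennreal (?g t' T \<xi>)"
      by (rule ennreal_plus) simp_all
    also have "ennreal (2 * ?g t t' \<xi>) = 2 * ennreal (?g t t' \<xi>)"
      by (subst ennreal_mult) simp_all
    finally show "ennreal ((?d \<xi>)\<^sup>2) + ennreal (?g t T \<xi>) \<le> 2 * ennreal (?g t t' \<xi>) + ennreal (?g t' T \<xi>)" .
  qed
  also have "\<dots> = 2 * (\<integral>\<^sup>+\<xi>. ennreal (?g t t' \<xi>) \<partial>lborel) + (\<integral>\<^sup>+\<xi>. ennreal (?g t' T \<xi>) \<partial>lborel)"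
    by (subst nn_integral_add) (simp_all add: nn_integral_cmult)
  also have "\<dots> = 2 * ennreal ((t' - t) powr p / D) + ennreal ((T - t') powr p / D)"
    unfolding nn_integral_k2_sq[OF \<alpha>(1) t(2)] nn_integral_k2_sq[OF \<alpha>(1) t(3)] p_def D_def ..
  finally have "ennreal (N + (T - t) powr p / D) \<le> ennreal (2 * ((t' - t) powr p / D) + (T - t') powr p / D)"
    using pos D by (simp only: ennreal_plus ennreal_mult divide_nonneg_pos powr_ge_zero mult_nonneg_nonneg zero_le_numeral ennreal_numeral)
  then have "N + (T - t) powr p / D \<le> 2 * ((t' - t) powr p / D) + (T - t') powr p / D"
    using D by (subst (asm) ennreal_le_iff) (auto intro!: add_nonneg_nonneg divide_nonneg_pos)
  moreover have "(T - t') powr p / D \<le> (T - t) powr p / D"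
    using t p D by (intro divide_right_mono powr_mono2) auto
  ultimately have "N \<le> 2 * ((t' - t) powr p / D)"
    by linarith
  moreover have "t' - t = \<bar>t - t'\<bar>"
    using t by simp
  ultimately have N_le: "N \<le> 2 * (\<bar>t - t'\<bar> powr p / D)"
    by (simp only:)
  show ?thesis
  proof (rule norm_blinfun_bound)
    show "0 \<le> sqrt (2 * (\<bar>t - t'\<bar> powr p / D))"
      using D by simp
    fix x :: 'b
    have "(sigma_op \<alpha> T t - sigma_op \<alpha> T t') x =
        sigma_op \<alpha> T t x + (-1) *\<^sub>R sigma_op \<alpha> T t' x"
      by (simp add: blinfun.diff_left)
    also have "\<dots> = abs_L2 (\<lambda>\<xi>. sigma_kernel \<alpha> T t \<xi> *\<^sub>R x + (-1) *\<^sub>R (sigma_kernel \<alpha> T t' \<xi> *\<^sub>R x))"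
      unfolding sigma_op_apply[OF \<alpha>(1)]
      by (simp only: abs_L2_add abs_L2_scaleR sq_integrable_sigma_kernel[OF \<alpha>(1)] sq_integrable_scaleR)
    also have "\<dots> = abs_L2 (\<lambda>\<xi>. ?d \<xi> *\<^sub>R x)"
      by (simp add: scaleR_diff_left)
    finally have "norm ((sigma_op \<alpha> T t - sigma_op \<alpha> T t') x) = sqrt N * norm x"
      by (simp only: norm_abs_L2_scaleR[OF sq] N_def)
    also have "\<dots> \<le> sqrt (2 * (\<bar>t - t'\<bar> powr p / D)) * norm x"
      using N_le by (intro mult_right_mono real_sqrt_le_mono) auto
    finally show "norm ((sigma_op \<alpha> T t - sigma_op \<alpha> T t') x) \<le> sqrt (2 * (\<bar>t - t'\<bar> powr p / D)) * norm x" .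
  qed
qed

lemma continuous_on_sigma_op:
  assumes \<alpha>: "1/2 < \<alpha>" "\<alpha> < 1"
  shows "continuous_on {0..T} (sigma_op \<alpha> T :: real \<Rightarrow> 'b::euclidean_space \<Rightarrow>\<^sub>L 'b L2)"
  unfolding continuous_on_def
proof
  fix t
  assume t: "t \<in> {0..T}"
  let ?b = "\<lambda>u. sqrt (2 * (\<bar>u - t\<bar> powr (2 * \<alpha> - 1) / ((2 * \<alpha> - 1) * (Gamma \<alpha>)\<^sup>2)))"
  have le: "norm (sigma_op \<alpha> T u - sigma_op \<alpha> T t :: 'b \<Rightarrow>\<^sub>L 'b L2) \<le> ?b u" if "u \<in> {0..T}" for u
  proof (cases "u \<le> t")
    case True
    then show ?thesis
      using norm_sigma_op_diff_le[OF \<alpha>, of u t T] t that by simp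
  next
    case False
    then show ?thesis
      using norm_sigma_op_diff_le[OF \<alpha>, of t u T] t that by (simp add: norm_minus_commute abs_minus_commute)
  qed
  have lim: "((\<lambda>u. \<bar>u - t\<bar>) \<longlongrightarrow> 0) (at t within {0..T})"
    by (rule tendsto_eq_intros | simp)+
  have "((\<lambda>u. \<bar>u - t\<bar> powr (2 * \<alpha> - 1)) \<longlongrightarrow> 0) (at t within {0..T})"
    using \<alpha> by (intro tendsto_zero_powrI[OF lim tendsto_const]) auto
  then have "(?b \<longlongrightarrow> sqrt (2 * (0 / ((2 * \<alpha> - 1) * (Gamma \<alpha>)\<^sup>2)))) (at t within {0..T})"
    unfolding divide_inverse by (intro tendsto_real_sqrt tendsto_mult_left tendsto_mult_right)
  then have "(?b \<longlongrightarrow> 0) (at t within {0..T})"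
    by simp
  then have "((\<lambda>u. sigma_op \<alpha> T u - sigma_op \<alpha> T t :: 'b \<Rightarrow>\<^sub>L 'b L2) \<longlongrightarrow> 0) (at t within {0..T})"
  proof (rule Lim_null_comparison[rotated])
    show "\<forall>\<^sub>F u in at t within {0..T}. norm (sigma_op \<alpha> T u - sigma_op \<alpha> T t :: 'b \<Rightarrow>\<^sub>L 'b L2) \<le> ?b u"
      unfolding eventually_at_filter by (intro always_eventually allI impI le)
  qed
  then show "(sigma_op \<alpha> T \<longlongrightarrow> (sigma_op \<alpha> T t :: 'b \<Rightarrow>\<^sub>L 'b L2)) (at t within {0..T})"
    by (rule LIM_zero_cancel)
qed

lemma Q_op_integrable:
  assumes \<alpha>: "1/2 < \<alpha>" "\<alpha> < 1" and "0 \<le> s" "s < t" "t \<le> T"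
  shows "(\<lambda>\<tau>. sigma_op \<alpha> T \<tau> o\<^sub>L blinfun_adjoint (sigma_op \<alpha> T \<tau> :: 'b::euclidean_space \<Rightarrow>\<^sub>L 'b L2)) integrable_on {T - t..T - s}"
proof (rule integrable_continuous_interval)
  have sub: "{T - t..T - s} \<subseteq> {0..T}"
    using assms by auto
  have cont: "continuous_on {T - t..T - s} (sigma_op \<alpha> T :: real \<Rightarrow> 'b \<Rightarrow>\<^sub>L 'b L2)"
    by (rule continuous_on_subset[OF continuous_on_sigma_op[OF \<alpha>] sub])
  have "continuous_on {T - t..T - s} (\<lambda>\<tau>. blinfun_adjoint (sigma_op \<alpha> T \<tau> :: 'b \<Rightarrow>\<^sub>L 'b L2))"
    unfolding continuous_on_def
  proof
    fix \<tau>
    assume "\<tau> \<in> {T - t..T - s}"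
    then have "((\<lambda>u. sigma_op \<alpha> T u - sigma_op \<alpha> T \<tau> :: 'b \<Rightarrow>\<^sub>L 'b L2) \<longlongrightarrow> 0) (at \<tau> within {T - t..T - s})"
      using cont by (intro LIM_zero) (simp add: continuous_on_def)
    then have "((\<lambda>u. norm (sigma_op \<alpha> T u - sigma_op \<alpha> T \<tau> :: 'b \<Rightarrow>\<^sub>L 'b L2)) \<longlongrightarrow> 0) (at \<tau> within {T - t..T - s})"
      by (rule tendsto_norm_zero)
    then have "((\<lambda>u. blinfun_adjoint (sigma_op \<alpha> T u :: 'b \<Rightarrow>\<^sub>L 'b L2) - blinfun_adjoint (sigma_op \<alpha> T \<tau>)) \<longlongrightarrow> 0)
        (at \<tau> within {T - t..T - s})"
      by (rule Lim_null_comparison[rotated])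
        (simp add: always_eventually blinfun_adjoint_inner(2) flip: blinfun_adjoint_diff)
    then show "((\<lambda>u. blinfun_adjoint (sigma_op \<alpha> T u :: 'b \<Rightarrow>\<^sub>L 'b L2)) \<longlongrightarrow> blinfun_adjoint (sigma_op \<alpha> T \<tau>))
        (at \<tau> within {T - t..T - s})"
      by (rule LIM_zero_cancel)
  qed
  then show "continuous_on {T - t..T - s} (\<lambda>\<tau>. sigma_op \<alpha> T \<tau> o\<^sub>L blinfun_adjoint (sigma_op \<alpha> T \<tau> :: 'b \<Rightarrow>\<^sub>L 'b L2))"
    by (rule bounded_bilinear.continuous_on[OF bounded_bilinear_blinfun_compose cont])
qed

lemma Q_op_in_L2_on:
  fixes h :: "'b::euclidean_space L2"
  assumes \<alpha>: "1/2 < \<alpha>" "\<alpha> < 1" and "0 \<le> s" "s < t" "t \<le> T"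
  shows "Q_op \<alpha> T t s h \<in> L2_on T"
proof -
  let ?S = "sigma_op \<alpha> T :: real \<Rightarrow> 'b \<Rightarrow>\<^sub>L 'b L2"
  let ?f = "Q_op \<alpha> T t s h"
  let ?r = "\<lambda>\<xi>. if \<xi> \<in> {0<..<T} then 0 else rep_L2 ?f \<xi>"
  have rep[measurable]: "rep_L2 ?f \<in> borel_measurable borel"
    by (rule sq_integrable_measurable[OF sq_integrable_rep_L2])
  have sq: "sq_integrable ?r"
    unfolding sq_integrable_def
  proof
    show "?r \<in> borel_measurable lborel"
      by measurable
    have "integrable lborel (\<lambda>\<xi>. (norm (rep_L2 ?f \<xi>))\<^sup>2)"
      using sq_integrable_rep_L2[of ?f] by (simp add: sq_integrable_def)
    then show "integrable lborel (\<lambda>\<xi>. (norm (?r \<xi>))\<^sup>2)"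
      by (rule Bochner_Integration.integrable_bound) auto
  qed
  define v where "v = abs_L2 ?r"
  have v: "AE \<xi> in lborel. rep_L2 v \<xi> = ?r \<xi>"
    unfolding v_def by (rule rep_abs_L2[OF sq])
  have orth: "?S \<tau> x \<bullet> v = 0" for \<tau> x
  proof -
    have "AE \<xi> in lborel. rep_L2 (?S \<tau> x) \<xi> \<bullet> rep_L2 v \<xi> = 0"
      using sigma_op_in_L2_on[OF \<alpha>(1), of T \<tau> x, unfolded L2_on_def mem_Collect_eq] v
      by eventually_elim auto
    then show ?thesis
      unfolding inner_L2_eq by (rule integral_eq_zero_AE)
  qed
  let ?I = "\<lambda>\<tau>. ?S \<tau> o\<^sub>L blinfun_adjoint (?S \<tau>)"
  have "(\<lambda>A :: 'b L2 \<Rightarrow>\<^sub>L 'b L2. A h \<bullet> v) = (\<lambda>x. x \<bullet> v) \<circ> (\<lambda>A. A h)"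
    by (simp add: o_def)
  then have bl: "bounded_linear (\<lambda>A :: 'b L2 \<Rightarrow>\<^sub>L 'b L2. A h \<bullet> v)"
    using bounded_linear_compose[OF bounded_linear_inner_left[of v] blinfun.bounded_linear_left[of h]]
    by simp
  have "?f \<bullet> v = integral {T - t..T - s} ((\<lambda>A :: 'b L2 \<Rightarrow>\<^sub>L 'b L2. A h \<bullet> v) \<circ> ?I)"
    unfolding Q_op_def by (rule integral_linear[OF Q_op_integrable[OF assms] bl, symmetric])
  also have "\<dots> = 0"
    by (simp add: o_def orth)
  finally have "(\<integral>\<xi>. rep_L2 ?f \<xi> \<bullet> rep_L2 v \<xi> \<partial>lborel) = 0"
    by (simp add: inner_L2_eq)
  moreover have "(\<integral>\<xi>. rep_L2 ?f \<xi> \<bullet> rep_L2 v \<xi> \<partial>lborel) = (\<integral>\<xi>. ?r \<xi> \<bullet> ?r \<xi> \<partial>lborel)"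
  proof (rule integral_cong_AE)
    show "AE \<xi> in lborel. rep_L2 ?f \<xi> \<bullet> rep_L2 v \<xi> = ?r \<xi> \<bullet> ?r \<xi>"
      using v by eventually_elim auto
    show "(\<lambda>\<xi>. rep_L2 ?f \<xi> \<bullet> rep_L2 v \<xi>) \<in> borel_measurable lborel"
      using sq_integrable_inner[OF sq_integrable_rep_L2 sq_integrable_rep_L2] by blast
    show "(\<lambda>\<xi>. ?r \<xi> \<bullet> ?r \<xi>) \<in> borel_measurable lborel"
      using sq_integrable_inner[OF sq sq] by blast
  qed
  ultimately have "AE \<xi> in lborel. ?r \<xi> \<bullet> ?r \<xi> = 0"
    using integral_nonneg_eq_0_iff_AE[OF sq_integrable_inner[OF sq sq]] by simp
  then show ?thesis
    unfolding L2_on_def mem_Collect_eq by eventually_elim auto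
qed

end

theory Submission
  imports Defs
begin

text \<open>
  Put \<open>u \<tau> = \<sigma>(\<tau>)\<^sup>* h\<close>, a continuous function on \<open>[T - t, T - s]\<close>, and let \<open>w\<close> be its extension by
  zero. Testing against \<open>v\<close> and exchanging the integrals shows that \<open>Q_T(t,s) h\<close> is represented
  on \<open>(0,T)\<close> by \<open>g \<xi> = \<integral> k\<^sub>2(\<xi> - \<tau>) w \<tau> d\<tau> = \<integral> k\<^sub>2(r) w (\<xi> - r) dr\<close>. In the second form \<open>\<xi>\<close> enters only
  through \<open>w\<close>, which is bounded and has at most two discontinuities, so \<open>g\<close> is continuous by
  dominated convergence.
\<close>

text \<open>The singular factor \<open>k\<close> stays fixed while \<xi> moves only the bounded
  factor, so \<bar>k r\<bar> * M dominates uniformly. Continuity is tested along sequences because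
  dominated convergence is a statement about sequences.\<close>

lemma continuous_convolution_bounded:
  fixes k :: "real \<Rightarrow> real" and w :: "real \<Rightarrow> 'b::euclidean_space"
  assumes k: "integrable lborel k"
    and w[measurable]: "w \<in> borel_measurable borel"
    and bound: "\<And>x. norm (w x) \<le> M"
    and N: "countable N" and cont: "\<And>x. x \<notin> N \<Longrightarrow> isCont w x"
  shows "isCont (\<lambda>\<xi>. \<integral>r. k r *\<^sub>R w (\<xi> - r) \<partial>lborel) \<xi>"
  unfolding continuous_at_sequentially o_def
proof (intro allI impI)
  fix X assume X: "X \<longlonglongrightarrow> \<xi>"
  have [measurable]: "k \<in> borel_measurable borel"
    using k by simp
  \<comment> \<open>The exceptional r are those for which \<xi> - r is a discontinuity of
    \<open>w\<close>; they form a reflected copy of \<open>N\<close>, hence a null set.\<close>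
  have "countable ((\<lambda>x. \<xi> - x) ` N)"
    using N by simp
  then have "AE r in lborel. r \<notin> (\<lambda>x. \<xi> - x) ` N"
    by (intro AE_not_in countable_imp_null_set_lborel)
  then have lim: "AE r in lborel. (\<lambda>n. k r *\<^sub>R w (X n - r)) \<longlonglongrightarrow> k r *\<^sub>R w (\<xi> - r)"
  proof eventually_elim
    case (elim r)
    then have "\<xi> - r \<notin> N"
      by (metis diff_diff_eq2 diff_add_cancel add_diff_cancel_left' imageI add.commute)
    then have "isCont w (\<xi> - r)"
      by (rule cont)
    moreover have "(\<lambda>n. X n - r) \<longlonglongrightarrow> \<xi> - r"
      using X by (intro tendsto_intros)
    ultimately show ?case
      by (intro tendsto_scaleR tendsto_const isCont_tendsto_compose[of _ w])
  qed
  show "(\<lambda>n. \<integral>r. k r *\<^sub>R w (X n - r) \<partial>lborel) \<longlonglongrightarrow> (\<integral>r. k r *\<^sub>R w (\<xi> - r) \<partial>lborel)"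
  proof (rule integral_dominated_convergence[where w = "\<lambda>r. \<bar>k r\<bar> * M", OF _ _ _ lim])
    show "integrable lborel (\<lambda>r. \<bar>k r\<bar> * M)"
      using k by simp
    show "AE r in lborel. norm (k r *\<^sub>R w (X n - r)) \<le> \<bar>k r\<bar> * M" for n
      using bound by (auto intro!: mult_left_mono)
  qed simp_all
qed

text \<open>Expanding in the finite basis turns each coordinate of the adjoint into
  \<open>sigma_op \<alpha> T \<tau> b \<bullet> h\<close>, which inherits the norm continuity of
  \<open>sigma_op\<close>.\<close>

lemma continuous_on_adjoint_sigma_op:
  fixes h :: "'b::euclidean_space L2"
  assumes "1/2 < \<alpha>" "\<alpha> < 1"
  shows "continuous_on {0..T} (\<lambda>\<tau>. blinfun_adjoint (sigma_op \<alpha> T \<tau>) h)"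
proof -
  have "blinfun_adjoint (sigma_op \<alpha> T \<tau>) h = (\<Sum>b\<in>Basis. (sigma_op \<alpha> T \<tau> b \<bullet> h) *\<^sub>R b)" for \<tau>
    by (simp only: blinfun_adjoint_inner(1) inner_commute[of _ "blinfun_adjoint _ h"] euclidean_representation)
  then show ?thesis
    by (simp only:) (intro continuous_intros continuous_on_sigma_op assms)
qed

lemma inner_sigma_op:
  fixes x :: "'b::euclidean_space"
  assumes "1/2 < \<alpha>"
  shows "sigma_op \<alpha> T \<tau> x \<bullet> v = (\<integral>\<xi>. sigma_kernel \<alpha> T \<tau> \<xi> * (x \<bullet> rep_L2 v \<xi>) \<partial>lborel)"
  unfolding sigma_op_apply[OF assms]
  by (subst abs_rep_L2[of v, symmetric], subst inner_abs_L2)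
    (simp_all add: sq_integrable_sigma_kernel[OF assms] sq_integrable_rep_L2)

text \<open>Evaluating at \<open>h\<close> and pairing with \<open>v\<close> is a bounded linear
  functional of the operator, so it passes through the operator-valued integral. The resulting
  scalar gauge integral is restated as a Lebesgue integral, the form in which Fubini
  applies.\<close>

lemma Q_op_inner:
  fixes h v :: "'b::euclidean_space L2"
  assumes \<alpha>: "1/2 < \<alpha>" "\<alpha> < 1" and "0 \<le> s" "s < t" "t \<le> T"
  defines "u \<equiv> \<lambda>\<tau>. blinfun_adjoint (sigma_op \<alpha> T \<tau> :: 'b \<Rightarrow>\<^sub>L 'b L2)"
  shows "Q_op \<alpha> T t s h \<bullet> v = (\<integral>\<tau>. indicator {T - t..T - s} \<tau> *\<^sub>R (sigma_op \<alpha> T \<tau> (u \<tau> h) \<bullet> v) \<partial>lborel)"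
proof -
  let ?I = "\<lambda>\<tau>. sigma_op \<alpha> T \<tau> o\<^sub>L u \<tau>"
  have bl: "bounded_linear (\<lambda>A :: 'b L2 \<Rightarrow>\<^sub>L 'b L2. A h \<bullet> v)"
    by (rule bounded_linear_compose[OF bounded_linear_inner_left blinfun.bounded_linear_left])
  \<comment> \<open>By adjointness this is the integrand of the claim, written so that both factors
    are known to be continuous.\<close>
  have "continuous_on {T - t..T - s} (\<lambda>\<tau>. u \<tau> h \<bullet> u \<tau> v)"
    unfolding u_def using assms(3-5)
    by (intro continuous_on_inner continuous_on_subset[OF continuous_on_adjoint_sigma_op[OF \<alpha>]]) auto
  then have "set_integrable lborel {T - t..T - s} (\<lambda>\<tau>. sigma_op \<alpha> T \<tau> (u \<tau> h) \<bullet> v)"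
    unfolding u_def blinfun_adjoint_inner(1) by (rule borel_integrable_atLeastAtMost')
  from set_borel_integral_eq_integral(2)[OF this]
  have "integral {T - t..T - s} ((\<lambda>A :: 'b L2 \<Rightarrow>\<^sub>L 'b L2. A h \<bullet> v) \<circ> ?I) =
      (\<integral>\<tau>. indicator {T - t..T - s} \<tau> *\<^sub>R (sigma_op \<alpha> T \<tau> (u \<tau> h) \<bullet> v) \<partial>lborel)"
    by (simp add: set_lebesgue_integral_def o_def)
  then show ?thesis
    unfolding Q_op_def u_def integral_linear[OF Q_op_integrable[OF assms(1-5)] bl] .
qed

text \<open>A square-integrable function supported in a bounded interval is integrable: pair it with
  the indicator of that interval.\<close>

lemma integrable_sigma_kernel_0:
  assumes "1/2 < \<alpha>"
  shows "integrable lborel (sigma_kernel \<alpha> T 0)"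
proof -
  have "integrable lborel (indicator {0<..<T} :: real \<Rightarrow> real)"
    by (cases "0 \<le> T") (auto intro!: integrable_real_indicator)
  moreover have "(\<lambda>x. (norm (indicator {0<..<T} x :: real))\<^sup>2) = indicator {0<..<T}"
    by (auto simp: indicator_def)
  ultimately have "sq_integrable (indicator {0<..<T} :: real \<Rightarrow> real)"
    by (simp add: sq_integrable_def)
  from sq_integrable_inner[OF this sq_integrable_sigma_kernel_real[OF assms, of T 0]]
  show ?thesis
    by (rule Bochner_Integration.integrable_cong[THEN iffD1, rotated -1])
      (auto simp: sigma_kernel_def indicator_def)
qed

text \<open>This justifies the exchange of integrals. Since 2xy is at most the sum of the squares,
  the \<xi>-integral of the modulus is bounded uniformly in \<tau>, and the bounded support of
  \<open>w\<close> makes the \<tau>-integral finite.\<close>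

lemma integrable_pair_sigma_kernel:
  fixes w v :: "real \<Rightarrow> 'b::euclidean_space"
  assumes \<alpha>: "1/2 < \<alpha>" and a: "0 \<le> a"
    and w[measurable]: "w \<in> borel_measurable borel"
    and bound: "\<And>\<tau>. norm (w \<tau>) \<le> M" and supp: "\<And>\<tau>. \<tau> \<notin> {a..b} \<Longrightarrow> w \<tau> = 0"
    and v: "sq_integrable v"
  shows "integrable (lborel \<Otimes>\<^sub>M lborel) (\<lambda>(\<tau>, \<xi>). sigma_kernel \<alpha> T \<tau> \<xi> * (w \<tau> \<bullet> v \<xi>))"
proof (rule integrableI_bounded)
  have v_meas[measurable]: "v \<in> borel_measurable borel"
    by (rule sq_integrable_measurable[OF v])
  show meas[measurable]: "(\<lambda>(\<tau>, \<xi>). sigma_kernel \<alpha> T \<tau> \<xi> * (w \<tau> \<bullet> v \<xi>)) \<in> borel_measurable (lborel \<Otimes>\<^sub>M lborel)"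
    unfolding sigma_kernel_def by measurable
  have M: "0 \<le> M"
    using bound[of 0] norm_ge_zero order_trans by blast
  \<comment> \<open>\<open>C\<close> is the value from \<open>nn_integral_k2_sq\<close> for the
    longest interval, starting at 0. As \<tau> \<ge> a \<ge> 0 on the support of \<open>w\<close>
    and the exponent is positive, it bounds the squared norm of every kernel that occurs.\<close>
  define C where "C = T powr (2 * \<alpha> - 1) / ((2 * \<alpha> - 1) * (Gamma \<alpha>)\<^sup>2)"
  define V where "V = (\<integral>\<xi>. (norm (v \<xi>))\<^sup>2 \<partial>lborel)"
  have C: "0 \<le> C"
    using \<alpha> by (simp add: C_def)
  have V: "0 \<le> V"
    by (simp add: V_def)
  have V_eq: "(\<integral>\<^sup>+\<xi>. ennreal ((norm (v \<xi>))\<^sup>2) \<partial>lborel) = ennreal V"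
    unfolding V_def by (rule nn_integral_eq_integral) (use v in \<open>auto simp: sq_integrable_def\<close>)
  have ptw: "norm (sigma_kernel \<alpha> T \<tau> \<xi> * (w \<tau> \<bullet> v \<xi>)) \<le>
      M * ((sigma_kernel \<alpha> T \<tau> \<xi>)\<^sup>2 + (norm (v \<xi>))\<^sup>2)" for \<tau> \<xi>
  proof -
    have "norm (sigma_kernel \<alpha> T \<tau> \<xi> * (w \<tau> \<bullet> v \<xi>)) \<le> \<bar>sigma_kernel \<alpha> T \<tau> \<xi>\<bar> * (M * norm (v \<xi>))"
      using mult_left_mono[OF order_trans[OF Cauchy_Schwarz_ineq2 mult_right_mono[OF bound norm_ge_zero]] abs_ge_zero]
      by (simp add: abs_mult)
    also have "\<dots> = M * (\<bar>sigma_kernel \<alpha> T \<tau> \<xi>\<bar> * norm (v \<xi>))"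
      by simp
    also have "\<bar>sigma_kernel \<alpha> T \<tau> \<xi>\<bar> * norm (v \<xi>) \<le> (sigma_kernel \<alpha> T \<tau> \<xi>)\<^sup>2 + (norm (v \<xi>))\<^sup>2"
      using sum_squares_bound[of "\<bar>sigma_kernel \<alpha> T \<tau> \<xi>\<bar>" "norm (v \<xi>)"]
        mult_nonneg_nonneg[OF abs_ge_zero norm_ge_zero, of "sigma_kernel \<alpha> T \<tau> \<xi>" "v \<xi>"]
      unfolding power2_abs mult.assoc by linarith
    finally show ?thesis
      using M by (simp add: mult_left_mono)
  qed
  have inner: "(\<integral>\<^sup>+\<xi>. ennreal (norm (sigma_kernel \<alpha> T \<tau> \<xi> * (w \<tau> \<bullet> v \<xi>))) \<partial>lborel) \<le>
      ennreal (M * (C + V)) * indicator {a..b} \<tau>" for \<tau>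
  proof (cases "\<tau> \<in> {a..b}")
    case True
    have kernel: "(\<integral>\<^sup>+\<xi>. ennreal ((sigma_kernel \<alpha> T \<tau> \<xi>)\<^sup>2) \<partial>lborel) \<le> ennreal C"
    proof (cases "\<tau> \<le> T")
      case le: True
      have "(\<integral>\<^sup>+\<xi>. ennreal ((sigma_kernel \<alpha> T \<tau> \<xi>)\<^sup>2) \<partial>lborel) \<le>
          (\<integral>\<^sup>+\<xi>. ennreal (indicator {\<tau><..T} \<xi> * (k2 \<alpha> (\<xi> - \<tau>))\<^sup>2) \<partial>lborel)"
        by (intro nn_integral_mono ennreal_leI) (auto simp: sigma_kernel_def indicator_def)
      also have "\<dots> \<le> ennreal C"
        unfolding nn_integral_k2_sq[OF \<alpha> le] C_def
        using \<alpha> a True le by (intro ennreal_leI divide_right_mono powr_mono2) auto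
      finally show ?thesis .
    next
      case False
      then have "sigma_kernel \<alpha> T \<tau> \<xi> = 0" for \<xi>
        by (simp add: sigma_kernel_def)
      then show ?thesis
        by simp
    qed
    have "(\<integral>\<^sup>+\<xi>. ennreal (norm (sigma_kernel \<alpha> T \<tau> \<xi> * (w \<tau> \<bullet> v \<xi>))) \<partial>lborel) \<le>
        (\<integral>\<^sup>+\<xi>. ennreal M * (ennreal ((sigma_kernel \<alpha> T \<tau> \<xi>)\<^sup>2) + ennreal ((norm (v \<xi>))\<^sup>2)) \<partial>lborel)"
      using ptw M by (intro nn_integral_mono) (simp flip: ennreal_plus ennreal_mult add: ennreal_leI)
    also have "\<dots> = ennreal M * ((\<integral>\<^sup>+\<xi>. ennreal ((sigma_kernel \<alpha> T \<tau> \<xi>)\<^sup>2) \<partial>lborel) + ennreal V)"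
      by (simp add: nn_integral_cmult nn_integral_add V_eq)
    also have "\<dots> \<le> ennreal M * (ennreal C + ennreal V)"
      by (intro mult_left_mono add_right_mono kernel) simp
    also have "\<dots> = ennreal (M * (C + V))"
      using M C V by (simp add: ennreal_mult)
    finally show ?thesis
      using True by simp
  qed (simp add: supp)
  have "(\<integral>\<^sup>+p. ennreal (norm (case p of (\<tau>, \<xi>) \<Rightarrow> sigma_kernel \<alpha> T \<tau> \<xi> * (w \<tau> \<bullet> v \<xi>))) \<partial>(lborel \<Otimes>\<^sub>M lborel)) =
      (\<integral>\<^sup>+\<tau>. \<integral>\<^sup>+\<xi>. ennreal (norm (sigma_kernel \<alpha> T \<tau> \<xi> * (w \<tau> \<bullet> v \<xi>))) \<partial>lborel \<partial>lborel)"
    by (subst lborel.nn_integral_fst[symmetric]) simp_all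
  also have "\<dots> \<le> (\<integral>\<^sup>+\<tau>. ennreal (M * (C + V)) * indicator {a..b} \<tau> \<partial>lborel)"
    by (intro nn_integral_mono inner)
  also have "\<dots> < \<infinity>"
    by (cases "a \<le> b") (auto simp: nn_integral_cmult ennreal_mult_less_top)
  finally show "(\<integral>\<^sup>+p. ennreal (norm (case p of (\<tau>, \<xi>) \<Rightarrow> sigma_kernel \<alpha> T \<tau> \<xi> * (w \<tau> \<bullet> v \<xi>)))
      \<partial>(lborel \<Otimes>\<^sub>M lborel)) < \<infinity>" .
qed

text \<open>The cut-off to \<open>(0,T)\<close> is not translation invariant. Here \<tau> \<ge> 0
  and \<xi> < T force \<xi> - \<tau> < T, so both cut-offs reduce to \<tau> < \<xi>.\<close>

lemma sigma_kernel_shift: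
  assumes "\<xi> \<in> {0<..<T}" and "0 \<le> \<tau>"
  shows "sigma_kernel \<alpha> T 0 (\<xi> - \<tau>) = sigma_kernel \<alpha> T \<tau> \<xi>"
  using assms by (auto simp: sigma_kernel_def)

lemma rep_Q_op_eq_continuous:
  fixes h :: "'b::euclidean_space L2"
  assumes \<alpha>: "1/2 < \<alpha>" "\<alpha> < 1" and st: "0 \<le> s" "s < t" "t \<le> T"
  shows "\<exists>g :: real \<Rightarrow> 'b. continuous_on {0<..<T} g \<and> (\<forall>\<xi> \<in> {0<..<T - t}. g \<xi> = 0) \<and>
    (AE \<xi> in lborel. \<xi> \<in> {0<..<T} \<longrightarrow> rep_L2 (Q_op \<alpha> T t s h) \<xi> = g \<xi>)"
proof -
  define a b where "a = T - t" and "b = T - s"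
  define u where "u \<tau> = blinfun_adjoint (sigma_op \<alpha> T \<tau>) h" for \<tau>
  define w where "w \<tau> = indicator {a..b} \<tau> *\<^sub>R u \<tau>" for \<tau>
  define k where "k = sigma_kernel \<alpha> T 0"
  \<comment> \<open>\<open>g\<close> is continuous on the whole line but need not vanish beyond
    \<open>T\<close>; \<open>g0\<close> is what the exchange of integrals produces, and it vanishes
    off \<open>(0,T)\<close>. The two agree on \<open>(0,T)\<close>.\<close>
  define g where "g \<xi> = (\<integral>r. k r *\<^sub>R w (\<xi> - r) \<partial>lborel)" for \<xi>
  define g0 where "g0 \<xi> = (\<integral>\<tau>. sigma_kernel \<alpha> T \<tau> \<xi> *\<^sub>R w \<tau> \<partial>lborel)" for \<xi>
  have ab: "0 \<le> a" "b \<le> T"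
    using st by (auto simp: a_def b_def)
  have u_cont: "continuous_on {a..b} u"
    unfolding u_def using ab
    by (intro continuous_on_subset[OF continuous_on_adjoint_sigma_op[OF \<alpha>]]) auto
  have w_supp: "w \<tau> = 0" if "\<tau> \<notin> {a..b}" for \<tau>
    using that by (auto simp: w_def)
  have w_meas[measurable]: "w \<in> borel_measurable borel"
    unfolding w_def by (rule borel_measurable_continuous_on_indicator[OF _ u_cont]) simp
  have w_cont: "isCont w x" if "x \<notin> {a, b}" for x
  proof (cases "x \<in> {a..b}")
    case True
    then have x: "x \<in> {a<..<b}"
      using that by auto
    have "continuous_on {a<..<b} w \<longleftrightarrow> continuous_on {a<..<b} u"
      by (intro continuous_on_cong) (auto simp: w_def)
    then have "continuous_on {a<..<b} w"
      using continuous_on_subset[OF u_cont greaterThanLessThan_subseteq_atLeastAtMost_iff[THEN iffD2]] by auto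
    then show ?thesis
      using x by (simp add: continuous_on_eq_continuous_at)
  next
    case False
    then have "x \<in> - {a..b}"
      by simp
    moreover have "continuous_on (- {a..b}) w"
      using w_supp by (subst continuous_on_cong[OF refl, of _ _ "\<lambda>_. 0"]) auto
    ultimately show ?thesis
      using closed_atLeastAtMost by (simp add: continuous_on_eq_continuous_at open_Compl)
  qed
  obtain M where M: "\<And>x. norm (w x) \<le> M"
  proof -
    have "bounded (u ` {a..b})"
      by (intro compact_imp_bounded compact_continuous_image u_cont) simp
    then obtain M where "0 < M" "\<And>x. x \<in> {a..b} \<Longrightarrow> norm (u x) \<le> M"
      unfolding bounded_pos by auto
    then show ?thesis
      by (intro that[of M]) (auto simp: w_def indicator_def)
  qed
  have k: "integrable lborel k"
    unfolding k_def by (rule integrable_sigma_kernel_0[OF \<alpha>(1)])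
  have g_cont: "continuous_on S g" for S
    unfolding g_def
    by (intro continuous_at_imp_continuous_on ballI
        continuous_convolution_bounded[where N = "{a, b}", OF k w_meas M _ w_cont]) auto
  \<comment> \<open>The factor \<open>w \<tau>\<close> kills every \<tau> outside
    \<open>[a,b]\<close>, in particular the negative ones, where the kernels may differ.\<close>
  have shift: "k (\<xi> - \<tau>) *\<^sub>R w \<tau> = sigma_kernel \<alpha> T \<tau> \<xi> *\<^sub>R w \<tau>" if "\<xi> \<in> {0<..<T}" for \<xi> \<tau>
    using ab w_supp[of \<tau>] sigma_kernel_shift[OF that, of \<tau> \<alpha>]
    by (cases "\<tau> \<in> {a..b}") (auto simp: k_def)
  have g_eq: "g \<xi> = g0 \<xi>" if "\<xi> \<in> {0<..<T}" for \<xi>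
  proof -
    \<comment> \<open>Substitute r = \<xi> - \<tau>; the factor -1 enters only through its absolute
      value.\<close>
    have "g \<xi> = (\<integral>\<tau>. k (\<xi> - \<tau>) *\<^sub>R w \<tau> \<partial>lborel)"
      unfolding g_def by (subst lborel_integral_real_affine[where c = "-1" and t = \<xi>]) simp_all
    then show ?thesis
      by (simp only: shift[OF that] g0_def)
  qed
  have g0_outside: "g0 \<xi> = 0" if "\<xi> \<notin> {0<..<T}" for \<xi>
    using that by (auto simp: g0_def sigma_kernel_def)
  have g_zero: "g \<xi> = 0" if "\<xi> \<in> {0<..<a}" for \<xi>
  proof -
    \<comment> \<open>Causality: \<open>k r\<close> is nonzero only for r > 0, and then \<xi> - r <
      \<xi> < a lies to the left of the support of \<open>w\<close>.\<close>
    have "k r *\<^sub>R w (\<xi> - r) = 0" for r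
      using that by (auto simp: k_def sigma_kernel_def w_def)
    then show ?thesis
      by (simp only: g_def Bochner_Integration.integral_zero)
  qed
  have g0_sq: "sq_integrable g0"
  proof -
    have g0_ind: "g0 \<xi> = indicator {0<..<T} \<xi> *\<^sub>R g \<xi>" for \<xi>
      using g_eq g0_outside by (auto simp: indicator_def)
    \<comment> \<open>Continuity of \<open>g\<close> up to both endpoints gives integrability on the
      compact interval, which then restricts to \<open>(0,T)\<close>.\<close>
    have "set_integrable lborel {0..T} (\<lambda>\<xi>. (norm (g \<xi>))\<^sup>2)"
      by (intro borel_integrable_atLeastAtMost' continuous_intros g_cont)
    then have "set_integrable lborel {0<..<T} (\<lambda>\<xi>. (norm (g \<xi>))\<^sup>2)"
      by (rule set_integrable_subset) auto
    then have "integrable lborel (\<lambda>\<xi>. (norm (g0 \<xi>))\<^sup>2)"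
      unfolding set_integrable_def
      by (rule Bochner_Integration.integrable_cong[THEN iffD1, rotated -1])
        (auto simp: g0_ind indicator_def)
    moreover have "g0 \<in> borel_measurable borel"
      unfolding g0_ind[abs_def] by (intro borel_measurable_continuous_on_indicator g_cont) simp
    ultimately show ?thesis
      by (simp add: sq_integrable_def)
  qed
  \<comment> \<open>Testing against every \<open>v\<close> in the whole space identifies the two
    classes.\<close>
  have "Q_op \<alpha> T t s h \<bullet> v = abs_L2 g0 \<bullet> v" for v
  proof -
    let ?v = "rep_L2 v"
    have int: "integrable (lborel \<Otimes>\<^sub>M lborel) (\<lambda>(\<tau>, \<xi>). sigma_kernel \<alpha> T \<tau> \<xi> * (w \<tau> \<bullet> ?v \<xi>))"
      by (rule integrable_pair_sigma_kernel[OF \<alpha>(1) ab(1) w_meas M w_supp sq_integrable_rep_L2])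
    \<comment> \<open>Linearity moves the indicator of the integration interval into the argument,
      turning \<open>u\<close> into \<open>w\<close>.\<close>
    have "Q_op \<alpha> T t s h \<bullet> v = (\<integral>\<tau>. sigma_op \<alpha> T \<tau> (w \<tau>) \<bullet> v \<partial>lborel)"
      unfolding Q_op_inner[OF assms] w_def u_def a_def b_def
      by (simp add: blinfun.scaleR_right)
    also have "\<dots> = (\<integral>\<tau>. \<integral>\<xi>. sigma_kernel \<alpha> T \<tau> \<xi> * (w \<tau> \<bullet> ?v \<xi>) \<partial>lborel \<partial>lborel)"
      by (simp only: inner_sigma_op[OF \<alpha>(1)])
    also have "\<dots> = (\<integral>\<xi>. \<integral>\<tau>. sigma_kernel \<alpha> T \<tau> \<xi> * (w \<tau> \<bullet> ?v \<xi>) \<partial>lborel \<partial>lborel)"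
      by (rule lborel_pair.Fubini_integral[OF int, symmetric])
    also have "\<dots> = (\<integral>\<xi>. g0 \<xi> \<bullet> ?v \<xi> \<partial>lborel)"
    proof (rule Bochner_Integration.integral_cong[OF refl])
      fix \<xi>
      \<comment> \<open>Integrability at every single \<xi> allows the inner product with
        \<open>?v \<xi>\<close> to be pulled out of the \<tau>-integral.\<close>
      have "integrable lborel (\<lambda>\<tau>. sigma_kernel \<alpha> T \<tau> \<xi> *\<^sub>R w \<tau>)"
      proof (cases "\<xi> \<in> {0<..<T}")
        case True
        have "integrable lborel (\<lambda>\<tau>. k (\<xi> - \<tau>) *\<^sub>R w \<tau>)"
        proof (rule Bochner_Integration.integrable_bound)
          show "integrable lborel (\<lambda>\<tau>. k (\<xi> - \<tau>) * M)"
            using lborel_integrable_real_affine[OF k, of "-1" \<xi>] by simp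
          show "(\<lambda>\<tau>. k (\<xi> - \<tau>) *\<^sub>R w \<tau>) \<in> borel_measurable lborel"
            unfolding k_def by measurable
          show "AE \<tau> in lborel. norm (k (\<xi> - \<tau>) *\<^sub>R w \<tau>) \<le> norm (k (\<xi> - \<tau>) * M)"
            using order_trans[OF M abs_ge_self]
            by (intro AE_I2) (simp add: abs_mult mult_left_mono)
        qed
        then show ?thesis
          by (simp only: shift[OF True])
      next
        case False
        then have "sigma_kernel \<alpha> T \<tau> \<xi> = 0" for \<tau>
          by (auto simp: sigma_kernel_def)
        then show ?thesis
          by simp
      qed
      then show "(\<integral>\<tau>. sigma_kernel \<alpha> T \<tau> \<xi> * (w \<tau> \<bullet> ?v \<xi>) \<partial>lborel) = g0 \<xi> \<bullet> ?v \<xi>"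
        unfolding g0_def by (subst integral_inner_left[symmetric]) auto
    qed
    also have "\<dots> = abs_L2 g0 \<bullet> v"
      by (subst (2) abs_rep_L2[of v, symmetric])
        (simp add: inner_abs_L2 g0_sq sq_integrable_rep_L2)
    finally show ?thesis .
  qed
  then have "Q_op \<alpha> T t s h = abs_L2 g0"
    using vector_eq_rdot by blast
  then have "AE \<xi> in lborel. \<xi> \<in> {0<..<T} \<longrightarrow> rep_L2 (Q_op \<alpha> T t s h) \<xi> = g \<xi>"
    using rep_abs_L2[OF g0_sq] by (auto simp: g_eq)
  then show ?thesis
    using g_cont g_zero unfolding a_def by blast
qed

theorem lemma10:
  fixes T \<alpha> s t :: real and f :: "(real ^ 'n) L2"
  assumes "0 < T" and "1 / 2 < \<alpha>" and "\<alpha> < 1"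
    and "0 \<le> s" and "s < t" and "t \<le> T"
    and "f \<in> blinfun_apply (Q_op \<alpha> T t s) ` L2_on T"
  shows "\<exists>g :: real \<Rightarrow> real ^ 'n. continuous_on {0<..<T} g \<and>
    (\<forall>\<xi> \<in> {0<..<T - t}. g \<xi> = 0) \<and>
    (AE \<xi> in lborel. \<xi> \<in> {0<..<T} \<longrightarrow> rep_L2 f \<xi> = g \<xi>)"
  using assms(7) rep_Q_op_eq_continuous[OF assms(2-6)] by blast

end
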